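(* Let $G$ be a finite group. Then the following are equivalent: (1) $G$ is abelian. (2) $G$ is $Q_8$-free, and any subgroup of $G$ is an $IC\Phi$-subgroup of $G$. (3) $G$ is $Q_8$-free, and any primary subgroup of $G$ is an $IC\Phi$-subgroup of $G$.
   Context: All groups are finite. For a group $G$ and a subgroup $H \le G$, $[H,G]$ denotes the subgroup generated by all commutators $[h,g]$ with $h \in H$, $g \in G$, and $\Phi(H)$ denotes the Frattini subgroup of $H$ (the intersection of all maximal subgroups of $H$, with $\Phi(1)=1$). A subgroup $H$ of $G$ is an $IC\Phi$-subgroup of $G$ if $H \cap [H,G] \le \Phi(H)$. A primary subgroup is a subgroup of prime power order. $Q_8$ is the quaternion group of order $8$; a group $G$ is $Q_8$-free if no section of $G$ (quotient $A/B$ with $B \trianglelefteq A \le G$) is isomorphic to $Q_8$. *)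

theory Defs
  imports "HOL-Algebra.Algebra"
begin

text \<open>
  The commutator convention is that of \<open>derived_set\<close>. Since \<open>H\<close> and \<open>K\<close> range over
  subgroups below, the convention \<open>h\<inverse>k\<inverse>hk\<close> yields the same set of commutators.
\<close>

definition commutator_subgroup :: "('a, 'b) monoid_scheme \<Rightarrow> 'a set \<Rightarrow> 'a set \<Rightarrow> 'a set" where
  "commutator_subgroup G H K =
     generate G (\<Union>h\<in>H. \<Union>k\<in>K. {h \<otimes>\<^bsub>G\<^esub> k \<otimes>\<^bsub>G\<^esub> inv\<^bsub>G\<^esub> h \<otimes>\<^bsub>G\<^esub> inv\<^bsub>G\<^esub> k})"

definition maximal_subgroup :: "'a set \<Rightarrow> ('a, 'b) monoid_scheme \<Rightarrow> bool" where
  "maximal_subgroup M G \<longleftrightarrow>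
     subgroup M G \<and> M \<noteq> carrier G \<and>
     (\<forall>K. subgroup K G \<and> M \<subseteq> K \<longrightarrow> K = M \<or> K = carrier G)"

text \<open>
  Intersecting with the carrier only matters when there is no maximal subgroup. For a finite group
  this happens exactly when the group is trivial, and then it gives \<open>\<Phi>(1) = 1\<close>.
\<close>

definition frattini :: "('a, 'b) monoid_scheme \<Rightarrow> 'a set" where
  "frattini G = carrier G \<inter> \<Inter>{M. maximal_subgroup M G}"

definition IC_Phi_subgroup :: "'a set \<Rightarrow> ('a, 'b) monoid_scheme \<Rightarrow> bool" where
  "IC_Phi_subgroup H G \<longleftrightarrow>
     subgroup H G \<and>
     H \<inter> commutator_subgroup G H (carrier G) \<subseteq> frattini (G\<lparr>carrier := H\<rparr>)"

text \<open>The trivial subgroup counts as primary (exponent 0); it is always an \<open>IC\<Phi>\<close>-subgroup.\<close>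

definition primary_subgroup :: "'a set \<Rightarrow> ('a, 'b) monoid_scheme \<Rightarrow> bool" where
  "primary_subgroup H G \<longleftrightarrow> subgroup H G \<and> (\<exists>(p::nat) n. Factorial_Ring.prime p \<and> card H = p ^ n)"

text \<open>
  The quaternion group \<open>{\<plusminus>1, \<plusminus>i, \<plusminus>j, \<plusminus>k}\<close>: the pair \<open>(s, u)\<close> stands for \<open>-u\<close> if \<open>s\<close> is true
  and for \<open>u\<close> otherwise. Inequality of truth values is exclusive or, so it multiplies signs.
\<close>

datatype quat_unit = Q1 | Qi | Qj | Qk

fun quat_unit_mult :: "quat_unit \<Rightarrow> quat_unit \<Rightarrow> bool \<times> quat_unit" where
  "quat_unit_mult Q1 u = (False, u)"
| "quat_unit_mult u Q1 = (False, u)"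
| "quat_unit_mult Qi Qi = (True, Q1)"
| "quat_unit_mult Qi Qj = (False, Qk)"
| "quat_unit_mult Qi Qk = (True, Qj)"
| "quat_unit_mult Qj Qi = (True, Qk)"
| "quat_unit_mult Qj Qj = (True, Q1)"
| "quat_unit_mult Qj Qk = (False, Qi)"
| "quat_unit_mult Qk Qi = (False, Qj)"
| "quat_unit_mult Qk Qj = (True, Qi)"
| "quat_unit_mult Qk Qk = (True, Q1)"

fun quat_mult :: "bool \<times> quat_unit \<Rightarrow> bool \<times> quat_unit \<Rightarrow> bool \<times> quat_unit" where
  "quat_mult (s, u) (t, v) = (case quat_unit_mult u v of (r, w) \<Rightarrow> ((s \<noteq> t) \<noteq> r, w))"

definition Q8 :: "(bool \<times> quat_unit) monoid" where
  "Q8 = \<lparr>carrier = UNIV, monoid.mult = quat_mult, one = (False, Q1)\<rparr>"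

lemma UNIV_quat_unit: "(UNIV :: quat_unit set) = {Q1, Qi, Qj, Qk}"
  using quat_unit.exhaust by auto

lemma group_Q8: "group Q8"
proof (rule groupI)
  fix x y z
  show "x \<otimes>\<^bsub>Q8\<^esub> y \<otimes>\<^bsub>Q8\<^esub> z = x \<otimes>\<^bsub>Q8\<^esub> (y \<otimes>\<^bsub>Q8\<^esub> z)"
    by (cases x; cases y; cases z; cases "snd x"; cases "snd y"; cases "snd z")
       (auto simp: Q8_def)
next
  fix x
  have "quat_mult ((snd x = Q1) = fst x, snd x) x = (False, Q1)"
    by (cases x; cases "snd x") auto
  then show "\<exists>y\<in>carrier Q8. y \<otimes>\<^bsub>Q8\<^esub> x = \<one>\<^bsub>Q8\<^esub>"
    unfolding Q8_def by (metis UNIV_I monoid.select_convs(1,2) partial_object.select_convs(1))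
qed (auto simp: Q8_def)

lemma order_Q8: "order Q8 = 8"
  by (simp add: order_def Q8_def UNIV_quat_unit card_cartesian_product flip: UNIV_Times_UNIV)

definition Q8_free :: "('a, 'b) monoid_scheme \<Rightarrow> bool" where
  "Q8_free G \<longleftrightarrow>
     \<not> (\<exists>A B. subgroup A G \<and> B \<lhd> G\<lparr>carrier := A\<rparr> \<and> (G\<lparr>carrier := A\<rparr> Mod B) \<cong> Q8)"

end

theory Submission
  imports Defs
begin

text \<open>
  The substance is that a nonabelian \<open>G\<close> whose primary subgroups are all \<open>IC\<Phi>\<close>-subgroups
  contains \<open>Q\<^sub>8\<close>. A minimal nonabelian subgroup of \<open>G\<close> has an abelian normal subgroup \<open>A\<close>
  that is not central. If \<open>x\<close> normalizes an abelian \<open>p\<close>-subgroup \<open>Q\<close>, the endomorphism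
  \<open>a \<mapsto> [a, x]\<close> of \<open>Q\<close> is nilpotent: it cannot be injective on its image \<open>D \<noteq> 1\<close>, as
  otherwise \<open>D = [D, x] \<le> \<Phi>(D)\<close>. This gives \<open>p\<close>-elements \<open>a, x\<close> whose commutator
  \<open>z \<noteq> 1\<close> commutes with both of them. Taking such a pair of least orders makes
  \<open>z\<close> of order \<open>p\<close>, puts \<open>z\<close> in both cyclic groups, and forces the relations
  \<open>a\<^sup>2 = x\<^sup>2 = [a, x]\<close>, \<open>p = 2\<close> of the quaternion group.
\<close>

section \<open>Commuting elements and central commutators\<close>

lemma (in monoid) pow_comm:
  assumes "x \<in> carrier G" "y \<in> carrier G" "x \<otimes> y = y \<otimes> x"
  shows "x [^] (n::nat) \<otimes> y [^] (m::nat) = y [^] m \<otimes> x [^] n"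
  using group_commutes_pow[of y "x [^] n" m] group_commutes_pow[of x y n] assms by simp

lemma (in monoid) left_commuteI:
  assumes "x \<in> carrier G" "y \<in> carrier G" "w \<in> carrier G" "x \<otimes> y = y \<otimes> x"
  shows "x \<otimes> (y \<otimes> w) = y \<otimes> (x \<otimes> w)"
  using assms by (simp add: m_assoc[symmetric])

lemma (in group) commutes_inv:
  assumes "x \<in> carrier G" "y \<in> carrier G" "x \<otimes> y = y \<otimes> x"
  shows "x \<otimes> inv y = inv y \<otimes> x"
proof -
  have "inv y \<otimes> x = inv y \<otimes> (x \<otimes> y) \<otimes> inv y"
    using assms(1,2) by (simp add: m_assoc)
  also have "\<dots> = x \<otimes> inv y"
    using assms(1,2) by (simp add: assms(3) m_assoc[symmetric])
  finally show ?thesis ..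
qed

text \<open>Here \<open>z\<close> is the commutator \<open>a b a^-1 b^-1\<close>. It has to commute
  with \<open>a\<close> and \<open>b\<close> only, so it is central in the subgroup that they
  generate, not necessarily in \<open>G\<close>.\<close>

locale central_commutator = group G for G (structure) +
  fixes a b z
  assumes a_carrier [simp]: "a \<in> carrier G"
    and b_carrier [simp]: "b \<in> carrier G"
    and z_carrier [simp]: "z \<in> carrier G"
    and ab: "a \<otimes> b = z \<otimes> (b \<otimes> a)"
    and az: "a \<otimes> z = z \<otimes> a"
    and bz: "b \<otimes> z = z \<otimes> b"
begin

lemma zpow_a: "z [^] (n::nat) \<otimes> a = a \<otimes> z [^] n"
  using pow_comm[OF z_carrier a_carrier az[symmetric], of n 1] by simp

lemma zpow_b: "z [^] (n::nat) \<otimes> b = b \<otimes> z [^] n"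
  using pow_comm[OF z_carrier b_carrier bz[symmetric], of n 1] by simp

lemma zpow_apow: "z [^] (n::nat) \<otimes> a [^] (m::nat) = a [^] m \<otimes> z [^] n"
  by (rule pow_comm) (simp_all add: az)

lemma apow_b: "a [^] (n::nat) \<otimes> b = z [^] n \<otimes> (b \<otimes> a [^] n)"
proof (induction n)
  case (Suc n)
  have "a [^] Suc n \<otimes> b = a [^] n \<otimes> (z \<otimes> (b \<otimes> a))"
    by (simp add: m_assoc ab)
  also have "\<dots> = z \<otimes> (a [^] n \<otimes> b) \<otimes> a"
    using zpow_apow[of 1 n] by (simp add: m_assoc[symmetric])
  also have "\<dots> = z \<otimes> z [^] n \<otimes> (b \<otimes> a [^] Suc n)"
    by (simp add: Suc m_assoc)
  also have "z \<otimes> z [^] n = z [^] Suc n"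
    using nat_pow_Suc2 by auto
  finally show ?case .
qed simp

lemma pow_left: "central_commutator G (a [^] (n::nat)) b (z [^] n)"
  by unfold_locales (simp_all add: apow_b zpow_apow zpow_b)

text \<open>The power formula for class two: moving the next \<open>b\<close> to the left past
  \<open>a^n\<close> costs \<open>z^n\<close>, and the exponents
  \<open>0 + 1 + ... + (n - 1)\<close> add up to \<open>n choose 2\<close>.\<close>

lemma pow_mult: "(b \<otimes> a) [^] (n::nat) = b [^] n \<otimes> a [^] n \<otimes> z [^] (n choose 2)"
proof (induction n)
  case (Suc n)
  let ?w = "z [^] (n choose 2)"
  have "(b \<otimes> a) [^] Suc n = b [^] n \<otimes> a [^] n \<otimes> (?w \<otimes> (b \<otimes> a))"
    by (simp add: Suc m_assoc)
  also have "?w \<otimes> (b \<otimes> a) = b \<otimes> a \<otimes> ?w"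
    by (simp add: m_assoc zpow_a left_commuteI[OF _ _ _ zpow_b])
  also have "b [^] n \<otimes> a [^] n \<otimes> (b \<otimes> a \<otimes> ?w) = b [^] n \<otimes> (a [^] n \<otimes> b) \<otimes> (a \<otimes> ?w)"
    by (simp add: m_assoc)
  also have "\<dots> = b [^] n \<otimes> (b \<otimes> a [^] n \<otimes> z [^] n) \<otimes> (a \<otimes> ?w)"
    by (simp add: apow_b m_assoc zpow_apow left_commuteI[OF _ _ _ zpow_b])
  also have "\<dots> = b [^] Suc n \<otimes> a [^] n \<otimes> (z [^] n \<otimes> a) \<otimes> ?w"
    by (simp add: m_assoc)
  also have "\<dots> = b [^] Suc n \<otimes> a [^] Suc n \<otimes> (z [^] n \<otimes> ?w)"
    by (simp add: zpow_a) (simp add: m_assoc)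
  also have "z [^] n \<otimes> ?w = z [^] (Suc n choose 2)"
    by (simp add: nat_pow_mult numeral_2_eq_2)
  finally show ?case .
qed (simp add: numeral_2_eq_2)

text \<open>This carries every result about the left element over to the right one.\<close>

lemma swap: "central_commutator G b a (inv z)"
proof unfold_locales
  show "b \<otimes> a = inv z \<otimes> (a \<otimes> b)"
    by (simp add: ab m_assoc[symmetric])
  show "b \<otimes> inv z = inv z \<otimes> b" "a \<otimes> inv z = inv z \<otimes> a"
    by (simp_all add: commutes_inv az bz)
qed simp_all

lemma pow_eq_one_left:
  assumes "a [^] (n::nat) = \<one>" shows "z [^] n = \<one>"
  using apow_b[of n] assms by simp

lemma pow_eq_one_right:
  assumes "b [^] (n::nat) = \<one>" shows "z [^] n = \<one>"
  using central_commutator.pow_eq_one_left[OF swap assms] by (simp add: nat_pow_inv)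

lemma commute_iff: "a \<otimes> b = b \<otimes> a \<longleftrightarrow> z = \<one>"
  unfolding ab using r_cancel[of z "b \<otimes> a" \<one>] by simp

text \<open>Since \<open>a\<close> commutes with its own powers, such a factor does not affect the
  commutator with \<open>a\<close>. This allows \<open>b\<close> to be traded for an element of
  smaller order.\<close>

lemma mult_pow_right: "central_commutator G a (b \<otimes> a [^] (n::nat)) z"
proof unfold_locales
  have "a \<otimes> (b \<otimes> a [^] n) = z \<otimes> (b \<otimes> a) \<otimes> a [^] n"
    by (simp add: m_assoc[symmetric] ab)
  also have "\<dots> = z \<otimes> (b \<otimes> a [^] n \<otimes> a)"
    using nat_pow_comm[of a 1 n] by (simp add: m_assoc)
  finally show "a \<otimes> (b \<otimes> a [^] n) = z \<otimes> (b \<otimes> a [^] n \<otimes> a)" .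
  show "b \<otimes> a [^] n \<otimes> z = z \<otimes> (b \<otimes> a [^] n)"
    using zpow_apow[of 1 n] left_commuteI[OF _ _ _ bz[symmetric], of "a [^] n"] by (simp add: m_assoc)
qed (simp_all add: az)

end

section \<open>Subgroups of finite groups and primary subgroups\<close>

lemma (in group) finite_subgroupI:
  assumes fin: "finite (carrier G)" and H: "H \<subseteq> carrier G" "H \<noteq> {}"
    and mult: "\<And>x y. x \<in> H \<Longrightarrow> y \<in> H \<Longrightarrow> x \<otimes> y \<in> H"
  shows "subgroup H G"
proof (rule subgroupI)
  fix x assume x: "x \<in> H"
  have pow: "x [^] Suc n \<in> H" for n
    by (induction n) (use x H mult in auto)
  have xc: "x \<in> carrier G" using x H by auto
  have "ord x > 0" using ord_ge_1[OF fin xc] by simp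
  \<comment> \<open>The inverse is the power with exponent \<open>ord x - 1\<close>. Order 1 is
    split off because \<open>pow\<close> covers positive exponents only.\<close>
  show "inv x \<in> H"
  proof (cases "ord x = 1")
    case True
    then have "x = \<one>" using ord_eq_1 xc by simp
    then show ?thesis using x by simp
  next
    case False
    then obtain k where k: "ord x = Suc (Suc k)" using \<open>ord x > 0\<close> 
      by (metis One_nat_def Suc_pred neq0_conv)
    have "x [^] Suc k \<otimes> x = \<one>" using pow_ord_eq_1[OF xc] k by simp
    then have "inv x = x [^] Suc k" using xc by (metis inv_equality nat_pow_closed)
    then show ?thesis using pow by simp
  qed
qed (use assms in auto)

lemma (in group) subgroup_nat_pow_closed:
  assumes "subgroup H G" "x \<in> H" shows "x [^] (n::nat) \<in> H"
  by (induction n) (use assms in \<open>auto intro: subgroup.m_closed subgroup.one_closed\<close>)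

lemma prime_power_of_unique_prime_divisor:
  fixes n p :: nat
  assumes p: "Factorial_Ring.prime p" and n: "n > 0"
    and unique: "\<And>r. Factorial_Ring.prime r \<Longrightarrow> r dvd n \<Longrightarrow> r = p"
  shows "\<exists>k. n = p ^ k"
proof -
  obtain k m where km: "\<not> p dvd m" "n = m * p ^ k"
    using prime_power_canonical[OF p n] by auto
  have "m = 1"
  proof (rule ccontr)
    assume "m \<noteq> 1"
    then obtain r where "Factorial_Ring.prime r" "r dvd m"
      using prime_factor_nat by blast
    then show False using unique[of r] km by auto
  qed
  then show ?thesis using km by auto
qed

text \<open>By Cauchy's theorem a prime \<open>r\<close> dividing \<open>card H\<close> is the order
  of an element of \<open>H\<close>. That order divides a power of \<open>p\<close>, so
  \<open>r = p\<close>.\<close>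

lemma (in group) primary_subgroupI:
  assumes fin: "finite (carrier G)" and H: "subgroup H G" and p: "Factorial_Ring.prime (p::nat)"
    and tors: "\<And>x. x \<in> H \<Longrightarrow> \<exists>k. x [^] (p ^ k) = \<one>"
  shows "primary_subgroup H G"
proof -
  have finH: "finite H" using fin H by (meson finite_subset subgroup.subset)
  have pos: "card H > 0" using H finH subgroup.one_closed by (metis card_gt_0_iff empty_iff)
  interpret H: group "G\<lparr>carrier := H\<rparr>" using H by (rule subgroup_imp_group)
  have "r = p" if r: "Factorial_Ring.prime r" "r dvd card H" for r :: nat
  proof -
    \<comment> \<open>Sylow's theorem for the exponent 1, which need not be the full exponent of
      \<open>r\<close>, gives a subgroup of order \<open>r\<close>.\<close>
    obtain m where "card H = r ^ 1 * m" using r by auto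
    then obtain K where K: "subgroup K (G\<lparr>carrier := H\<rparr>)" "card K = r"
      using sylow_thm[OF r(1) H.group_axioms, of 1 m] finH by (auto simp: order_def)
    have KG: "subgroup K G" using K H incl_subgroup by blast
    interpret K: group "G\<lparr>carrier := K\<rparr>" using KG by (rule subgroup_imp_group)
    have "\<exists>x\<in>K. x \<noteq> \<one>"
    proof (rule ccontr)
      assume "\<not> ?thesis" then have "K \<subseteq> {\<one>}" by auto
      then have "card K \<le> 1" using card_mono[of "{\<one>}" K] by simp
      then show False using K(2) prime_gt_1_nat[OF r(1)] by simp
    qed
    then obtain x where x: "x \<in> K" "x \<noteq> \<one>" by auto
    have xc: "x \<in> carrier G" using x(1) subgroup.subset[OF KG] by blast
    have xH: "x \<in> H" using x(1) subgroup.subset[OF K(1)] by auto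
    have "x [^] r = \<one>"
      using K.pow_order_eq_1[of x] x K(2) nat_pow_consistent[of x r K] by (simp add: order_def)
    then have "ord x dvd r" using pow_eq_id xc by blast
    then have "ord x = r" using r(1) x(2) ord_eq_1[OF xc] by (metis prime_nat_iff)
    moreover obtain k where "x [^] (p ^ k) = \<one>" using tors xH by auto
    ultimately have "r dvd p ^ k" using pow_eq_id xc by blast
    then show "r = p" using r(1) p by (metis prime_dvd_power primes_dvd_imp_eq)
  qed
  then have "\<exists>n. card H = p ^ n"
    using prime_power_of_unique_prime_divisor[OF p pos] by blast
  then show ?thesis using H p unfolding primary_subgroup_def by blast
qed

section \<open>Frattini subgroups and the IC\<Phi> condition\<close>

lemma (in group) frattini_neq_carrier:
  assumes fin: "finite (carrier G)" and nontriv: "carrier G \<noteq> {\<one>}"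
  shows "frattini G \<noteq> carrier G"
proof -
  \<comment> \<open>A maximal member of the finite family \<open>?S\<close> is a maximal subgroup;
    nontriviality of the group makes the family nonempty.\<close>
  let ?S = "{H. subgroup H G \<and> H \<noteq> carrier G}"
  have "?S \<subseteq> Pow (carrier G)" by (auto dest: subgroup.subset)
  then have "finite ?S" using fin by (meson finite_Pow_iff finite_subset)
  moreover have "{\<one>} \<in> ?S" using nontriv triv_subgroup by auto
  ultimately obtain M where M: "M \<in> ?S" "\<And>K. K \<in> ?S \<Longrightarrow> M \<subseteq> K \<Longrightarrow> M = K"
    using finite_has_maximal[of ?S] by blast
  then have "maximal_subgroup M G" unfolding maximal_subgroup_def by blast
  then have "frattini G \<subseteq> M" unfolding frattini_def by blast
  then show ?thesis using M(1) by (auto dest: subgroup.subset)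
qed

lemma (in group) commutator_in_commutator_subgroup:
  assumes "h \<in> H" "k \<in> K"
  shows "h \<otimes> k \<otimes> inv h \<otimes> inv k \<in> commutator_subgroup G H K"
  unfolding commutator_subgroup_def using assms by (intro generate.incl) blast

text \<open>Under the last hypothesis \<open>D \<inter> [D, G]\<close> is all of \<open>D\<close>,
  so \<open>D\<close> equals its Frattini subgroup, which only the trivial group does.\<close>

lemma (in group) IC_Phi_subgroup_trivialI:
  assumes fin: "finite (carrier G)" and IC: "IC_Phi_subgroup D G"
    and D: "D \<subseteq> commutator_subgroup G D (carrier G)"
  shows "D = {\<one>}"
proof -
  have sub: "subgroup D G" using IC unfolding IC_Phi_subgroup_def by simp
  interpret D: group "G\<lparr>carrier := D\<rparr>" using sub by (rule subgroup_imp_group)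
  have "D \<subseteq> frattini (G\<lparr>carrier := D\<rparr>)" using IC D unfolding IC_Phi_subgroup_def by blast
  then have "frattini (G\<lparr>carrier := D\<rparr>) = D" unfolding frattini_def by auto
  moreover have "finite D" using fin sub by (meson finite_subset subgroup.subset)
  ultimately show ?thesis using D.frattini_neq_carrier by auto
qed

text \<open>Commutation with \<open>x\<close> is an endomorphism \<open>\<phi>\<close> of
  \<open>Q\<close>. A nontrivial element of its image that lies in its kernel is a commutator
  \<open>[a, x]\<close> commuting with \<open>x\<close>, which can serve as \<open>z\<close>.
  Without such an element \<open>\<phi>\<close> permutes its image; the IC\<Phi> condition then
  makes the image trivial, against the choice of \<open>y\<close>.\<close>

lemma (in group) exists_central_commutator:
  assumes fin: "finite (carrier G)"
    and IC: "\<And>H. primary_subgroup H G \<Longrightarrow> IC_Phi_subgroup H G"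
    and Q: "subgroup Q G" and p: "Factorial_Ring.prime (p::nat)"
    and tors: "\<And>q. q \<in> Q \<Longrightarrow> \<exists>k. q [^] (p ^ k) = \<one>"
    and comm: "\<And>q r. q \<in> Q \<Longrightarrow> r \<in> Q \<Longrightarrow> q \<otimes> r = r \<otimes> q"
    and x: "x \<in> carrier G" and norm: "\<And>q. q \<in> Q \<Longrightarrow> x \<otimes> q \<otimes> inv x \<in> Q"
    and y: "y \<in> Q" "y \<otimes> x \<noteq> x \<otimes> y"
  shows "\<exists>a\<in>Q. \<exists>z. z \<noteq> \<one> \<and> central_commutator G a x z"
proof (rule ccontr)
  assume contra: "\<not> ?thesis"
  note Qc [simp] = subgroup.mem_carrier[OF Q] and Qm = subgroup.m_closed[OF Q]
    and Qi = subgroup.m_inv_closed[OF Q]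
  define \<phi> where "\<phi> = (\<lambda>q. q \<otimes> x \<otimes> inv q \<otimes> inv x)"
  have \<phi>_alt: "\<phi> q = q \<otimes> inv (x \<otimes> q \<otimes> inv x)" if "q \<in> Q" for q
    using that x by (simp add: \<phi>_def inv_mult_group m_assoc)
  have \<phi>Q: "\<phi> q \<in> Q" if "q \<in> Q" for q
    using that by (simp add: \<phi>_alt norm Qm Qi)
  have \<phi>_comm: "q \<otimes> x = \<phi> q \<otimes> (x \<otimes> q)" if "q \<in> Q" for q
    using that x by (simp add: \<phi>_def m_assoc) (simp add: m_assoc[symmetric])
  have \<phi>_one: "\<phi> q = \<one> \<longleftrightarrow> q \<otimes> x = x \<otimes> q" if "q \<in> Q" for q
    unfolding \<phi>_comm[OF that] using that x \<phi>Q[OF that] r_cancel[of "\<phi> q" "x \<otimes> q" \<one>] by simp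
  have \<phi>_mult: "\<phi> (q \<otimes> r) = \<phi> q \<otimes> \<phi> r" if qr: "q \<in> Q" "r \<in> Q" for q r
  proof -
    let ?c = "\<lambda>q. inv (x \<otimes> q \<otimes> inv x)"
    have c: "?c q \<in> Q" "?c r \<in> Q" using qr by (simp_all add: norm Qi)
    have "x \<otimes> (q \<otimes> r) \<otimes> inv x = x \<otimes> q \<otimes> inv x \<otimes> (x \<otimes> r \<otimes> inv x)"
      using qr x by (simp add: m_assoc) (simp add: m_assoc[symmetric])
    then have "?c (q \<otimes> r) = ?c r \<otimes> ?c q"
      using qr x by (simp add: inv_mult_group)
    then have "\<phi> (q \<otimes> r) = q \<otimes> (r \<otimes> ?c r \<otimes> ?c q)"
      using qr c by (simp add: \<phi>_alt Qm m_assoc)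
    also have "r \<otimes> ?c r \<otimes> ?c q = ?c q \<otimes> (r \<otimes> ?c r)"
      using qr c by (intro comm) (simp_all add: Qm)
    also have "q \<otimes> (?c q \<otimes> (r \<otimes> ?c r)) = \<phi> q \<otimes> \<phi> r"
      using qr c by (simp add: \<phi>_alt m_assoc)
    finally show ?thesis .
  qed
  define D where "D = \<phi> ` Q"
  have DQ: "D \<subseteq> Q" using \<phi>Q by (auto simp: D_def)
  have finD: "finite D" using finite_subset[OF subset_trans[OF DQ subgroup.subset[OF Q]] fin] .
  have subD: "subgroup D G"
  proof (rule finite_subgroupI[OF fin])
    show "D \<subseteq> carrier G" using DQ by auto
    show "D \<noteq> {}" using y by (auto simp: D_def)
    show "u \<otimes> v \<in> D" if "u \<in> D" "v \<in> D" for u v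
      using that Qm by (auto simp: D_def simp flip: \<phi>_mult)
  qed
  have "primary_subgroup D G"
    by (rule primary_subgroupI[OF fin subD p]) (use tors DQ in blast)
  then have ICD: "IC_Phi_subgroup D G" by (rule IC)
  \<comment> \<open>Such a \<open>u = \<phi> a\<close> commutes with \<open>x\<close> by
    \<open>\<phi>_one\<close>, and with \<open>a\<close> because both lie in the abelian
    \<open>Q\<close>.\<close>
  have ker: "u = \<one>" if u: "u \<in> D" "\<phi> u = \<one>" for u
  proof (rule ccontr)
    assume "u \<noteq> \<one>"
    obtain a where a: "a \<in> Q" "u = \<phi> a" using u by (auto simp: D_def)
    have uQ: "u \<in> Q" using u DQ by auto
    have "central_commutator G a x u"
    proof unfold_locales
      show "a \<otimes> x = u \<otimes> (x \<otimes> a)" unfolding a(2) by (rule \<phi>_comm[OF a(1)])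
      show "a \<otimes> u = u \<otimes> a" using a(1) uQ by (rule comm)
      show "x \<otimes> u = u \<otimes> x" using \<phi>_one[OF uQ] u(2) by simp
    qed (use a(1) uQ x in simp_all)
    then show False using contra a(1) \<open>u \<noteq> \<one>\<close> by blast
  qed
  have "inj_on \<phi> D"
  proof (rule inj_onI)
    fix u v assume uv: "u \<in> D" "v \<in> D" "\<phi> u = \<phi> v"
    have Q': "u \<in> Q" "v \<in> Q" "inv v \<in> Q" using uv DQ Qi by auto
    have d: "u \<otimes> inv v \<in> D"
      using uv subD by (simp add: subgroup.m_closed subgroup.m_inv_closed)
    have "\<phi> (u \<otimes> inv v) = \<phi> (v \<otimes> inv v)"
      using uv(3) Q' by (simp only: \<phi>_mult)
    also have "\<dots> = \<one>" using Q' x by (simp add: \<phi>_def)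
    finally have "u \<otimes> inv v = \<one>" using ker d by blast
    then show "u = v" using inv_equality[of u "inv v"] Q' by simp
  qed
  moreover have "\<phi> ` D \<subseteq> D" using DQ by (auto simp: D_def)
  \<comment> \<open>By finiteness an injective self-map is onto, so every element of
    \<open>D\<close> is a commutator of an element of \<open>D\<close> with
    \<open>x\<close>.\<close>
  ultimately have "\<phi> ` D = D" using finD by (simp add: endo_inj_surj)
  moreover have "\<phi> u \<in> commutator_subgroup G D (carrier G)" if "u \<in> D" for u
    unfolding \<phi>_def using that x by (rule commutator_in_commutator_subgroup)
  ultimately have "D \<subseteq> commutator_subgroup G D (carrier G)" by (metis imageE subsetI)
  then have "D = {\<one>}" by (rule IC_Phi_subgroup_trivialI[OF fin ICD])
  then have "\<phi> y = \<one>" using y(1) by (auto simp: D_def)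
  then show False using \<phi>_one y by blast
qed

section \<open>Commutators of order p as powers of one element\<close>

lemma (in monoid) pow_coprime_inverse:
  assumes z: "z \<in> carrier G" "z [^] p = \<one>"
    and p: "Factorial_Ring.prime (p::nat)" "\<not> p dvd j"
  shows "\<exists>t::nat. (z [^] (j::nat)) [^] t = z"
proof -
  have "coprime j p" using p by (metis coprime_commute prime_imp_coprime)
  moreover have "j \<noteq> 0" using p by (metis dvd_0_right)
  \<comment> \<open>The Bezout coefficient \<open>t\<close> inverts \<open>j\<close> modulo
    \<open>p\<close>; \<open>j \<noteq> 0\<close> allows the identity to be solved in natural
    numbers.\<close>
  ultimately obtain t r where "j * t = p * r + 1"
    using bezout_nat[of j p] by (metis coprime_imp_gcd_eq_1)
  then have "(z [^] j) [^] t = (z [^] p) [^] r \<otimes> z"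
    using z(1) by (simp add: nat_pow_pow)
  then show ?thesis using z by auto
qed

text \<open>
  Otherwise \<open>\<langle>a\<rangle>\<close> would be a maximal subgroup of \<open>H = \<langle>a, z\<rangle>\<close> which misses the
  commutator \<open>z\<close>, contradicting \<open>H \<inter> [H,G] \<le> \<Phi>(H)\<close>.
\<close>

lemma (in central_commutator) z_eq_power:
  assumes fin: "finite (carrier G)"
    and IC: "\<And>H. primary_subgroup H G \<Longrightarrow> IC_Phi_subgroup H G"
    and p: "Factorial_Ring.prime (p::nat)" and a: "a [^] (p ^ k) = \<one>"
    and z: "z [^] p = \<one>"
  shows "\<exists>n::nat. z = a [^] n"
proof (rule ccontr)
  assume contra: "\<not> ?thesis"
  \<comment> \<open>Nonnegative exponents suffice in a finite group, so \<open>M\<close> and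
    \<open>H\<close> are the subgroups generated by \<open>a\<close> and by
    \<open>a, z\<close>.\<close>
  define M where "M = {a [^] n |n::nat. True}"
  define H where "H = {a [^] i \<otimes> z [^] j |(i::nat) (j::nat). True}"
  have aM: "a [^] n \<in> M" for n :: nat by (auto simp: M_def)
  have M: "subgroup M G"
  proof (rule finite_subgroupI[OF fin])
    show "u \<otimes> v \<in> M" if "u \<in> M" "v \<in> M" for u v
      using that by (auto simp: M_def nat_pow_mult)
  qed (auto simp: M_def)
  have H: "subgroup H G"
  proof (rule finite_subgroupI[OF fin])
    fix u v assume "u \<in> H" "v \<in> H"
    then obtain i j i' j' :: nat where uv: "u = a [^] i \<otimes> z [^] j" "v = a [^] i' \<otimes> z [^] j'"
      unfolding H_def by blast
    have "u \<otimes> v = a [^] (i + i') \<otimes> z [^] (j + j')"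
      by (simp add: uv m_assoc left_commuteI[OF _ _ _ zpow_apow] flip: nat_pow_mult)
    then show "u \<otimes> v \<in> H" by (auto simp: H_def)
  qed (auto simp: H_def)
  have MH: "M \<subseteq> H"
  proof
    fix u assume "u \<in> M"
    then obtain n :: nat where "u = a [^] n \<otimes> z [^] (0::nat)" by (auto simp: M_def)
    then show "u \<in> H" unfolding H_def by blast
  qed
  have "z = a [^] (0::nat) \<otimes> z [^] (1::nat)" by simp
  then have zH: "z \<in> H" unfolding H_def by blast
  have "a [^] (1::nat) \<in> M" by (rule aM)
  then have aH: "a \<in> H" using MH by auto
  have zM: "z \<notin> M" using contra by (auto simp: M_def)
  have "primary_subgroup H G"
  proof (rule primary_subgroupI[OF fin H p])
    fix u assume "u \<in> H"
    then obtain i j :: nat where u: "u = a [^] i \<otimes> z [^] j" by (auto simp: H_def)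
    \<comment> \<open>The exponent is a common multiple of \<open>p ^ k\<close> and
      \<open>p\<close>, so it kills both factors.\<close>
    have "u [^] (p ^ Suc k) = (a [^] i) [^] (p ^ Suc k) \<otimes> (z [^] j) [^] (p ^ Suc k)"
      unfolding u by (rule pow_mult_distrib) (simp_all add: zpow_apow)
    also have "(a [^] i) [^] (p ^ Suc k) = (a [^] (p ^ k)) [^] (i * p)"
      by (simp add: nat_pow_pow ac_simps)
    also have "(z [^] j) [^] (p ^ Suc k) = (z [^] p) [^] (j * p ^ k)"
      by (simp add: nat_pow_pow ac_simps)
    finally have "u [^] (p ^ Suc k) = \<one>" using a z by simp
    then show "\<exists>k. u [^] (p ^ k) = \<one>" by blast
  qed
  then have "H \<inter> commutator_subgroup G H (carrier G) \<subseteq> frattini (G\<lparr>carrier := H\<rparr>)"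
    using IC unfolding IC_Phi_subgroup_def by blast
  moreover have "a \<otimes> b \<otimes> inv a \<otimes> inv b = z"
    by (simp add: ab m_assoc)
  then have "z \<in> commutator_subgroup G H (carrier G)"
    using commutator_in_commutator_subgroup[OF aH b_carrier] by simp
  ultimately have "z \<in> frattini (G\<lparr>carrier := H\<rparr>)" using zH by blast
  moreover have "maximal_subgroup M (G\<lparr>carrier := H\<rparr>)"
    unfolding maximal_subgroup_def
  proof (intro conjI allI impI)
    show "subgroup M (G\<lparr>carrier := H\<rparr>)" using M H MH by (rule subgroup_incl)
    show "M \<noteq> carrier (G\<lparr>carrier := H\<rparr>)" using zM zH by auto
    fix K assume K: "subgroup K (G\<lparr>carrier := H\<rparr>) \<and> M \<subseteq> K"
    then have KG: "subgroup K G" and KH: "K \<subseteq> H"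
      using H incl_subgroup subgroup.subset by force+
    show "K = M \<or> K = carrier (G\<lparr>carrier := H\<rparr>)"
    proof (cases "K = M")
      case False
      then obtain u where u: "u \<in> K" "u \<notin> M" using K by blast
      then obtain i j :: nat where uij: "u = a [^] i \<otimes> z [^] j" using KH by (auto simp: H_def)
      \<comment> \<open>Otherwise \<open>z^j\<close> is trivial and \<open>u\<close> lies in
        \<open>M\<close>. With \<open>j\<close> prime to \<open>p\<close>, \<open>z\<close> is a
        power of \<open>z^j\<close>, so every \<open>K\<close> strictly above \<open>M\<close>
        contains \<open>z\<close> and hence all of \<open>H\<close>.\<close>
      have "\<not> p dvd j"
      proof
        assume "p dvd j"
        then obtain r where "j = p * r" by blast
        then have "z [^] j = (z [^] p) [^] r" by (simp add: nat_pow_pow)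
        then have "u = a [^] i" using z by (simp add: uij)
        then show False using u(2) aM by simp
      qed
      then obtain t :: nat where t: "(z [^] j) [^] t = z"
        using pow_coprime_inverse[OF z_carrier z p] by blast
      have aK: "a [^] n \<in> K" for n :: nat using aM K by blast
      have "z [^] j = inv (a [^] i) \<otimes> u" by (simp add: uij m_assoc[symmetric])
      then have "z [^] j \<in> K"
        using u(1) aK KG by (simp add: subgroup.m_closed subgroup.m_inv_closed)
      then have "z \<in> K" using subgroup_nat_pow_closed[OF KG] t by metis
      then have "a [^] i \<otimes> z [^] j \<in> K" for i j :: nat
        using aK subgroup_nat_pow_closed[OF KG] by (simp add: subgroup.m_closed[OF KG])
      then have "H \<subseteq> K" by (auto simp: H_def)
      then show ?thesis using KH by auto
    qed simp
  qed
  ultimately show False using zM unfolding frattini_def by blast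
qed

section \<open>Minimal nonabelian groups\<close>

lemma (in group) conj_nat_pow:
  assumes "g \<in> carrier G" "x \<in> carrier G"
  shows "(g \<otimes> x \<otimes> inv g) [^] (n::nat) = g \<otimes> x [^] n \<otimes> inv g"
proof (induction n)
  case (Suc n)
  have "inv g \<otimes> (g \<otimes> (x \<otimes> inv g)) = x \<otimes> inv g"
    using assms by (simp add: m_assoc[symmetric])
  then show ?case using assms by (simp add: Suc) (simp add: m_assoc)
qed (use assms in simp)

text \<open>
  Commutation is transitive on the complement of the centre \<open>Z\<close>, so the sets \<open>C(y) - Z\<close>
  partition it. If no \<open>C(y)\<close> were normal, each would be self-normalizing, and the conjugates of a
  single \<open>C(y) - Z\<close> would already cover at least half of \<open>G\<close>, but not all of \<open>G - Z\<close>: two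
  conjugacy classes of centralizers do not fit into \<open>G - {1}\<close>.
\<close>

lemma (in group) minimal_nonabelian_has_abelian_normal:
  assumes fin: "finite (carrier G)"
    and nonab: "\<exists>x\<in>carrier G. \<exists>y\<in>carrier G. x \<otimes> y \<noteq> y \<otimes> x"
    and min: "\<And>K. subgroup K G \<Longrightarrow> K \<noteq> carrier G \<Longrightarrow> \<forall>x\<in>K. \<forall>y\<in>K. x \<otimes> y = y \<otimes> x"
  shows "\<exists>A. subgroup A G \<and> (\<forall>a\<in>A. \<forall>b\<in>A. a \<otimes> b = b \<otimes> a) \<and>
           (\<forall>g\<in>carrier G. \<forall>a\<in>A. g \<otimes> a \<otimes> inv g \<in> A) \<and>
           (\<exists>x\<in>carrier G. \<exists>y\<in>A. y \<otimes> x \<noteq> x \<otimes> y)"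
proof (rule ccontr)
  assume contra: "\<not> ?thesis"
  define C where "C y = {g \<in> carrier G. g \<otimes> y = y \<otimes> g}" for y
  define Z where "Z = {z \<in> carrier G. \<forall>g\<in>carrier G. z \<otimes> g = g \<otimes> z}"
  define cj where "cj g x = g \<otimes> x \<otimes> inv g" for g x
  have cj_closed [simp]: "cj g x \<in> carrier G" if "g \<in> carrier G" "x \<in> carrier G" for g x
    using that by (simp add: cj_def)
  have cj_cj: "cj g (cj h x) = cj (g \<otimes> h) x"
    if "g \<in> carrier G" "h \<in> carrier G" "x \<in> carrier G" for g h x
    using that by (simp add: cj_def m_assoc inv_mult_group)
  have cj_one: "cj \<one> x = x" if "x \<in> carrier G" for x using that by (simp add: cj_def)
  have cj_mult: "cj g (x \<otimes> y) = cj g x \<otimes> cj g y"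
    if "g \<in> carrier G" "x \<in> carrier G" "y \<in> carrier G" for g x y
  proof -
    have "inv g \<otimes> (g \<otimes> (y \<otimes> inv g)) = y \<otimes> inv g"
      using that by (simp add: m_assoc[symmetric])
    then show ?thesis using that by (simp add: cj_def m_assoc)
  qed
  have cj_commute: "cj g x = x" if "g \<in> carrier G" "x \<in> carrier G" "g \<otimes> x = x \<otimes> g" for g x
    using that by (simp add: cj_def m_assoc)
  have CG: "C y \<subseteq> carrier G" and ZG: "Z \<subseteq> carrier G" for y by (auto simp: C_def Z_def)
  have finC: "finite (C y)" and finZ: "finite Z" for y
    using finite_subset[OF CG fin] finite_subset[OF ZG fin] by auto
  have Zone: "\<one> \<in> Z" by (auto simp: Z_def)
  have C_self: "y \<in> C y" if "y \<in> carrier G" for y using that by (simp add: C_def)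
  have C_sub: "subgroup (C y) G" if "y \<in> carrier G" for y
  proof (rule finite_subgroupI[OF fin CG])
    show "C y \<noteq> {}" using C_self that by auto
    show "u \<otimes> v \<in> C y" if "u \<in> C y" "v \<in> C y" for u v
      using that \<open>y \<in> carrier G\<close> left_commuteI[of u y v] by (auto simp: C_def m_assoc)
  qed
  have C_proper: "C y \<noteq> carrier G" if "y \<in> carrier G" "y \<notin> Z" for y
  proof
    assume "C y = carrier G"
    then have "g \<otimes> y = y \<otimes> g" if "g \<in> carrier G" for g using that by (auto simp: C_def)
    then show False using that by (auto simp: Z_def)
  qed
  \<comment> \<open>The centralizer of a noncentral element is proper, hence abelian by minimality.
    This is the source of the transitivity of commutation.\<close>
  have C_comm: "u \<otimes> v = v \<otimes> u" if "y \<in> carrier G" "y \<notin> Z" "u \<in> C y" "v \<in> C y" for y u v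
    using min[OF C_sub C_proper] that by blast
  have C_eq: "C a = C y" if "y \<in> carrier G" "y \<notin> Z" "a \<in> C y" "a \<notin> Z" for a y
  proof
    have aG: "a \<in> carrier G" using that(3) CG by blast
    show "C y \<subseteq> C a"
    proof
      fix u assume u: "u \<in> C y"
      then show "u \<in> C a" using C_comm[OF that(1,2) u that(3)] CG by (auto simp: C_def)
    qed
    have ya: "y \<in> C a" using that by (simp add: C_def)
    show "C a \<subseteq> C y"
    proof
      fix u assume u: "u \<in> C a"
      then show "u \<in> C y" using C_comm[OF aG that(4) u ya] CG by (auto simp: C_def)
    qed
  qed
  have cj_C_sub: "cj g ` C u \<subseteq> C (cj g u)" if "g \<in> carrier G" "u \<in> carrier G" for g u
    using that by (auto simp: C_def simp flip: cj_mult)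
  have cj_inv: "cj (inv g) (cj g u) = u" "cj g (cj (inv g) u) = u"
    if "g \<in> carrier G" "u \<in> carrier G" for g u
    using that by (simp_all add: cj_cj cj_one)
  have cj_C: "cj g ` C u = C (cj g u)" if "g \<in> carrier G" "u \<in> carrier G" for g u
  proof
    show "C (cj g u) \<subseteq> cj g ` C u"
    proof
      fix w assume w: "w \<in> C (cj g u)"
      then have "cj (inv g) w \<in> C u"
        using cj_C_sub[of "inv g" "cj g u"] that by (auto simp: cj_inv)
      moreover have "w \<in> carrier G" using w CG by blast
      then have "w = cj g (cj (inv g) w)" using cj_inv(2) that(1) by simp
      ultimately show "w \<in> cj g ` C u" by blast
    qed
  qed (rule cj_C_sub[OF that])
  have cj_Z: "cj g a \<notin> Z" if "g \<in> carrier G" "a \<in> carrier G" "a \<notin> Z" for g a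
  proof
    assume Z: "cj g a \<in> Z"
    then have "cj (inv g) (cj g a) = cj g a"
      using that by (intro cj_commute) (auto simp: Z_def)
    then show False using Z that by (simp add: cj_inv)
  qed
  \<comment> \<open>The normalizer \<open>N\<close> of \<open>C y\<close> contains \<open>g\<close>
    and \<open>C y\<close>. It is proper, as otherwise \<open>C y\<close> would be an abelian normal
    subgroup that is not central. By minimality \<open>N\<close> is abelian, so \<open>g\<close>
    commutes with \<open>y\<close>.\<close>
  have self_normalizing: "g \<in> C y"
    if y: "y \<in> carrier G" "y \<notin> Z" and g: "g \<in> carrier G"
      and a: "a \<in> C y" "a \<notin> Z" "cj g a \<in> C y" for g a y
  proof -
    have aG: "a \<in> carrier G" using a(1) CG by blast
    define N where "N = {g \<in> carrier G. cj g ` C y = C y}"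
    have "cj g ` C y = C (cj g a)" using C_eq[OF y a(1,2)] cj_C[OF g aG] by simp
    also have "\<dots> = C y" using C_eq[OF y a(3)] cj_Z[OF g aG a(2)] by simp
    finally have "g \<in> N" using g by (simp add: N_def)
    have CN: "C y \<subseteq> N"
    proof
      fix c assume c: "c \<in> C y"
      then have "c \<in> carrier G" "cj c y = y" using y by (auto simp: C_def cj_commute)
      then show "c \<in> N" using cj_C[of c y] y by (simp add: N_def)
    qed
    have "subgroup N G"
    proof (rule finite_subgroupI[OF fin])
      show "N \<noteq> {}" using \<open>g \<in> N\<close> by auto
      show "u \<otimes> v \<in> N" if "u \<in> N" "v \<in> N" for u v
      proof -
        have uv: "u \<in> carrier G" "v \<in> carrier G" "cj u ` C y = C y" "cj v ` C y = C y"
          using that by (auto simp: N_def)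
        have "cj (u \<otimes> v) ` C y = (\<lambda>x. cj u (cj v x)) ` C y"
          using uv subsetD[OF CG] by (intro image_cong refl) (simp add: cj_cj)
        also have "\<dots> = C y" using uv by (metis image_image)
        finally show ?thesis using uv by (simp add: N_def)
      qed
    qed (auto simp: N_def)
    moreover have "N \<noteq> carrier G"
    proof
      assume "N = carrier G"
      then have "cj h c \<in> C y" if "h \<in> carrier G" "c \<in> C y" for h c
        using that by (auto simp: N_def)
      moreover have "\<exists>x\<in>carrier G. y \<otimes> x \<noteq> x \<otimes> y" using y by (auto simp: Z_def)
      ultimately show False
        using contra C_sub[OF y(1)] C_comm[OF y] C_self[OF y(1)] unfolding cj_def by blast
    qed
    ultimately have "g \<otimes> y = y \<otimes> g" using min \<open>g \<in> N\<close> CN C_self[OF y(1)] by blast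
    then show ?thesis using g by (simp add: C_def)
  qed
  \<comment> \<open>The union of all conjugates of \<open>C y - Z\<close>.\<close>
  define S where "S y = (\<lambda>(g, a). cj g a) ` (carrier G \<times> (C y - Z))" for y
  have S_sub: "S y \<subseteq> carrier G - Z" for y
    using subsetD[OF CG] cj_Z by (auto simp: S_def)
  have finS: "finite (S y)" for y using S_sub[of y] fin by (meson finite_Diff finite_subset)
  have card_S: "card (carrier G) * card (C y - Z) = card (S y) * card (C y)"
    if y: "y \<in> carrier G" "y \<notin> Z" for y
  proof -
    let ?P = "carrier G \<times> (C y - Z)" and ?f = "\<lambda>(g, a). cj g a"
    have finP: "finite ?P" using fin finC by auto
    \<comment> \<open>The fibre over \<open>cj h b\<close> consists of the pairs
      \<open>(h c, b)\<close> with \<open>c \<in> C y\<close>: if \<open>cj g a = cj h b\<close>,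
      then \<open>inv h g\<close> carries \<open>a\<close> into \<open>C y\<close>, so it lies in
      \<open>C y\<close> by \<open>self_normalizing\<close> and fixes \<open>a\<close>.\<close>
    have fibre: "card {x \<in> ?P. ?f x = s} = card (C y)" if s: "s \<in> S y" for s
    proof -
      obtain h b where hb: "h \<in> carrier G" "b \<in> C y" "b \<notin> Z" "s = cj h b"
        using s by (auto simp: S_def)
      have bG: "b \<in> carrier G" using hb CG by blast
      have "{x \<in> ?P. ?f x = s} = (\<lambda>c. (h \<otimes> c, b)) ` C y"
      proof
        show "(\<lambda>c. (h \<otimes> c, b)) ` C y \<subseteq> {x \<in> ?P. ?f x = s}"
        proof
          fix x assume "x \<in> (\<lambda>c. (h \<otimes> c, b)) ` C y"
          then obtain c where c: "c \<in> C y" "x = (h \<otimes> c, b)" by blast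
          have cG: "c \<in> carrier G" using c CG by blast
          have "cj c b = b" using C_comm[OF y c(1) hb(2)] cG bG by (rule cj_commute[rotated 2])
          then have "cj (h \<otimes> c) b = s" using hb cG bG by (simp flip: cj_cj)
          then show "x \<in> {x \<in> ?P. ?f x = s}" using c hb cG by auto
        qed
        show "{x \<in> ?P. ?f x = s} \<subseteq> (\<lambda>c. (h \<otimes> c, b)) ` C y"
        proof
          fix x assume "x \<in> {x \<in> ?P. ?f x = s}"
          then obtain g a where x: "x = (g, a)" "g \<in> carrier G" "a \<in> C y" "a \<notin> Z" "cj g a = cj h b"
            using hb(4) by auto
          have aG: "a \<in> carrier G" using x CG by blast
          have *: "cj (inv h \<otimes> g) a = b"
            using x hb bG aG by (simp add: cj_inv flip: cj_cj)
          then have k: "inv h \<otimes> g \<in> C y"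
            using self_normalizing[OF y _ x(3,4)] hb x by auto
          have "cj (inv h \<otimes> g) a = a"
            using C_comm[OF y k x(3)] hb x aG by (intro cj_commute) auto
          then have "a = b" using * by simp
          moreover have "g = h \<otimes> (inv h \<otimes> g)" using x hb by (simp add: m_assoc[symmetric])
          ultimately show "x \<in> (\<lambda>c. (h \<otimes> c, b)) ` C y" using x k by blast
        qed
      qed
      moreover have "inj_on (\<lambda>c. (h \<otimes> c, b)) (C y)"
        using hb subsetD[OF CG] by (auto intro!: inj_onI)
      ultimately show ?thesis by (simp add: card_image)
    qed
    have "card ?P = (\<Sum>s\<in>S y. card {x \<in> ?P. ?f x = s})"
      using sum.image_gen[OF finP, of "\<lambda>_. 1::nat" ?f] by (simp add: S_def)
    then show ?thesis using fibre by (simp add: card_cartesian_product)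
  qed
  have card_C: "card (C y) = card Z + card (C y - Z)" if "y \<in> carrier G" for y
  proof -
    have "Z \<subseteq> C y" using that by (auto simp: C_def Z_def)
    then show ?thesis using card_Diff_subset[OF finZ] card_mono[OF finC] by (metis le_add_diff_inverse)
  qed
  \<comment> \<open>The coset \<open>y Z\<close> lies in \<open>C y - Z\<close>, so \<open>Z\<close>
    fills at most half of \<open>C y\<close>; \<open>card_S\<close> transfers this bound to
    \<open>S y\<close>.\<close>
  have half: "2 * card (S y) \<ge> card (carrier G)" if y: "y \<in> carrier G" "y \<notin> Z" for y
  proof -
    have "(\<lambda>z. y \<otimes> z) ` Z \<subseteq> C y - Z"
    proof
      fix w assume "w \<in> (\<lambda>z. y \<otimes> z) ` Z"
      then obtain z where z: "z \<in> Z" "w = y \<otimes> z" by blast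
      have zG: "z \<in> carrier G" and zc: "z \<otimes> g = g \<otimes> z" if "g \<in> carrier G" for g
        using z that by (auto simp: Z_def)
      have zG': "z \<in> carrier G" using zG y(1) by blast
      have "y \<in> Z" if wZ: "w \<in> Z"
      proof -
        have "y \<otimes> g = g \<otimes> y" if g: "g \<in> carrier G" for g
        proof -
          have "y \<otimes> g \<otimes> z = w \<otimes> g" using z g y zG' zc[OF g] by (simp add: m_assoc)
          also have "\<dots> = g \<otimes> w" using wZ g by (auto simp: Z_def)
          also have "\<dots> = g \<otimes> y \<otimes> z" using z g y zG' by (simp add: m_assoc)
          finally show ?thesis using g y zG' by simp
        qed
        then show ?thesis using y by (auto simp: Z_def)
      qed
      moreover have "w \<in> C y" using z y zG' zc[OF y(1)] by (simp add: C_def m_assoc)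
      ultimately show "w \<in> C y - Z" using y by blast
    qed
    then have "card ((\<lambda>z. y \<otimes> z) ` Z) \<le> card (C y - Z)" using finC by (intro card_mono) auto
    moreover have "inj_on (\<lambda>z. y \<otimes> z) Z" using y subsetD[OF ZG] by (auto intro!: inj_onI)
    ultimately have "card Z \<le> card (C y - Z)" by (simp add: card_image)
    then have "card (C y) \<le> 2 * card (C y - Z)" using card_C[OF y(1)] by simp
    then have "card (carrier G) * card (C y) \<le> 2 * (card (carrier G) * card (C y - Z))"
      by (metis mult.left_commute mult_le_mono2)
    then have "card (carrier G) * card (C y) \<le> (2 * card (S y)) * card (C y)"
      by (simp add: card_S[OF y] mult.assoc)
    moreover have "card (C y) > 0" using finC C_self[OF y(1)] by (auto simp: card_gt_0_iff)
    ultimately show ?thesis by simp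
  qed
  obtain y where y: "y \<in> carrier G" "y \<notin> Z" using nonab by (auto simp: Z_def)
  \<comment> \<open>Equality together with \<open>card_S\<close> would give \<open>C y\<close> the
    order of the whole group, although \<open>y\<close> is not central.\<close>
  have "carrier G - Z \<noteq> S y"
  proof
    assume "carrier G - Z = S y"
    then have "card (carrier G) = card (S y) + card Z"
      using card_Diff_subset[OF finZ ZG] card_mono[OF fin ZG] by simp
    then have "card (carrier G) * card (C y) = card (S y) * card (C y) + card Z * card (C y)"
      by (simp add: algebra_simps)
    also have "\<dots> = card (carrier G) * card (C y - Z) + card Z * card (C y)"
      by (simp add: card_S[OF y])
    finally have "card (carrier G) * card Z = card (C y) * card Z"
      by (simp add: card_C[OF y(1)] algebra_simps)
    moreover have "card Z > 0" using finZ Zone by (auto simp: card_gt_0_iff)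
    ultimately have "card (C y) = card (carrier G)" by simp
    then show False using C_proper[OF y] card_subset_eq[OF fin CG] by blast
  qed
  then obtain w where w: "w \<in> carrier G" "w \<notin> Z" "w \<notin> S y" using S_sub by blast
  \<comment> \<open>A common element makes \<open>C w\<close> conjugate to \<open>C y\<close>, so
    \<open>w\<close> would be conjugate to an element of \<open>C y - Z\<close>, against its
    choice.\<close>
  have disj: "S w \<inter> S y = {}"
  proof (rule ccontr)
    assume "S w \<inter> S y \<noteq> {}"
    then obtain s where s: "s \<in> S w" "s \<in> S y" by blast
    obtain g a where ga: "g \<in> carrier G" "a \<in> C w" "a \<notin> Z" "s = cj g a"
      using s(1) by (auto simp: S_def)
    obtain h b where hb: "h \<in> carrier G" "b \<in> C y" "b \<notin> Z" "s = cj h b"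
      using s(2) by (auto simp: S_def)
    have G: "a \<in> carrier G" "b \<in> carrier G" using ga(2) hb(2) CG by blast+
    let ?k = "inv h \<otimes> g"
    have k: "?k \<in> carrier G" using ga hb by simp
    have "cj ?k a = cj (inv h) (cj h b)" using ga hb G by (simp flip: cj_cj)
    then have "cj ?k a = b" using hb G by (simp add: cj_inv)
    then have "cj ?k ` C w = C y"
      using cj_C[OF k G(1)] C_eq[OF w(1,2) ga(2,3)] C_eq[OF y hb(2,3)] by simp
    then have "cj ?k w \<in> C y" using C_self[OF w(1)] by blast
    moreover have "cj ?k w \<notin> Z" using cj_Z[OF k w(1,2)] .
    moreover have "w = cj (inv ?k) (cj ?k w)" using cj_inv(1)[OF k w(1)] by simp
    moreover have "inv ?k \<in> carrier G" using k by simp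
    ultimately have "w \<in> S y"
      unfolding S_def by (intro image_eqI[where x = "(inv ?k, cj ?k w)"]) auto
    then show False using w(3) by simp
  qed
  have "card (S w) + card (S y) = card (S w \<union> S y)"
    using card_Un_disjoint[OF finS finS disj] by simp
  also have "\<dots> < card (carrier G)"
  proof (rule psubset_card_mono[OF fin])
    have "\<one> \<notin> S w \<union> S y" using S_sub Zone by blast
    then show "S w \<union> S y \<subset> carrier G" using S_sub by blast
  qed
  finally show False using half[OF w(1,2)] half[OF y] by simp
qed

section \<open>Reduction to elements of prime power order\<close>

lemma (in group) prime_power_noncommuting:
  assumes fin: "finite (carrier G)" and K: "subgroup K G"
    and x: "x \<in> K" and y: "y \<in> carrier G" and xy: "x \<otimes> y \<noteq> y \<otimes> x"
  shows "\<exists>u\<in>K. \<exists>p k. Factorial_Ring.prime (p::nat) \<and> u [^] (p ^ k) = \<one> \<and> u \<otimes> y \<noteq> y \<otimes> u"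
proof -
  \<comment> \<open>Least order forces prime power order: for each prime \<open>r\<close> dividing
    \<open>ord u\<close>, the power \<open>u^r\<close> has smaller order and therefore commutes with
    \<open>y\<close>.\<close>
  obtain u where u: "u \<in> K" "u \<otimes> y \<noteq> y \<otimes> u"
    and least: "\<And>v. v \<in> K \<Longrightarrow> v \<otimes> y \<noteq> y \<otimes> v \<Longrightarrow> ord u \<le> ord v"
    using ex_has_least_nat[of "\<lambda>u. u \<in> K \<and> u \<otimes> y \<noteq> y \<otimes> u" x ord] x xy by blast
  have uG: "u \<in> carrier G" using u K by (auto dest: subgroup.mem_carrier)
  have pos: "ord u > 0" using ord_ge_1[OF fin uG] by simp
  have "u \<noteq> \<one>" using u y by auto
  then have "ord u \<noteq> 1" using ord_eq_1[OF uG] by simp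
  then obtain p where p: "Factorial_Ring.prime p" "p dvd ord u" using prime_factor_nat by blast
  have prime_pow: "u [^] (r * t) \<otimes> y = y \<otimes> u [^] (r * t)"
    if r: "Factorial_Ring.prime r" "r dvd ord u" for r t :: nat
  proof -
    obtain m where m: "ord u = r * m" using r(2) by blast
    have "(u [^] r) [^] m = \<one>" using uG m pow_ord_eq_1[OF uG] by (simp add: nat_pow_pow)
    then have "ord (u [^] r) dvd m" using pow_eq_id uG by simp
    moreover have "m < ord u" "m > 0" using m pos prime_gt_1_nat[OF r(1)] by auto
    ultimately have "ord (u [^] r) < ord u"
      using dvd_imp_le[of "ord (u [^] r)" m] by linarith
    then have "u [^] r \<otimes> y = y \<otimes> u [^] r"
      using least[OF subgroup_nat_pow_closed[OF K u(1), of r]] by linarith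
    then show ?thesis using group_commutes_pow[of "u [^] r" y t] uG y by (simp add: nat_pow_pow)
  qed
  have "r = p" if r: "Factorial_Ring.prime r" "r dvd ord u" for r
  proof (rule ccontr)
    assume "r \<noteq> p"
    then have "coprime r p" by (rule primes_coprime[OF r(1) p(1)])
    moreover have "r \<noteq> 0" using prime_gt_0_nat[OF r(1)] by simp
    \<comment> \<open>For two distinct primes, Bezout makes \<open>u\<close> a quotient of two
      powers that commute with \<open>y\<close>.\<close>
    ultimately obtain s t where "r * s = p * t + 1"
      using bezout_nat[of r p] by auto
    then have eq: "u [^] (r * s) = u [^] (p * t) \<otimes> u" by simp
    let ?v = "u [^] (p * t)"
    have "?v \<otimes> (u \<otimes> y) = y \<otimes> (?v \<otimes> u)"
      using prime_pow[OF r, of s] uG y by (simp add: eq m_assoc)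
    also have "\<dots> = ?v \<otimes> (y \<otimes> u)"
      using prime_pow[OF p, of t] uG y by (simp flip: m_assoc)
    finally show False using u(2) uG y by simp
  qed
  then obtain k where "ord u = p ^ k"
    using prime_power_of_unique_prime_divisor[OF p(1) pos] by blast
  then have "u [^] (p ^ k) = \<one>" using pow_ord_eq_1[OF uG] by simp
  then show ?thesis using u p by blast
qed

lemma (in group) exists_prime_power_central_commutator:
  assumes fin: "finite (carrier G)"
    and IC: "\<And>H. primary_subgroup H G \<Longrightarrow> IC_Phi_subgroup H G"
    and nonab: "\<not> comm_group G"
  shows "\<exists>a x z (p::nat) k l. Factorial_Ring.prime p \<and> z \<noteq> \<one> \<and> central_commutator G a x z \<and>
           a [^] (p ^ k) = \<one> \<and> x [^] (p ^ l) = \<one>"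
proof -
  let ?nonab = "\<lambda>H. subgroup H G \<and> (\<exists>x\<in>H. \<exists>y\<in>H. x \<otimes> y \<noteq> y \<otimes> x)"
  have "?nonab (carrier G)"
    using nonab group_comm_groupI subgroup_self by blast
  \<comment> \<open>Least cardinality makes all proper subgroups of \<open>H\<close>
    abelian.\<close>
  then obtain H where H: "?nonab H" and least: "\<And>K. ?nonab K \<Longrightarrow> card H \<le> card K"
    using ex_has_least_nat[of ?nonab "carrier G" card] by blast
  have subH: "subgroup H G" using H by blast
  have finH: "finite H" using finite_subset[OF subgroup.subset[OF subH] fin] .
  interpret H: group "G\<lparr>carrier := H\<rparr>" using subH by (rule subgroup_imp_group)
  have "\<exists>A. subgroup A (G\<lparr>carrier := H\<rparr>) \<and> (\<forall>a\<in>A. \<forall>b\<in>A. a \<otimes> b = b \<otimes> a) \<and>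
     (\<forall>g\<in>H. \<forall>a\<in>A. g \<otimes> a \<otimes> inv\<^bsub>G\<lparr>carrier := H\<rparr>\<^esub> g \<in> A) \<and>
     (\<exists>x\<in>H. \<exists>y\<in>A. y \<otimes> x \<noteq> x \<otimes> y)"
  proof (rule H.minimal_nonabelian_has_abelian_normal[simplified])
    show "finite H" by (rule finH)
    show "\<exists>x\<in>H. \<exists>y\<in>H. x \<otimes> y \<noteq> y \<otimes> x" using H by blast
    fix K assume K: "subgroup K (G\<lparr>carrier := H\<rparr>)" "K \<noteq> H"
    then have "K \<subset> H" using subgroup.subset by fastforce
    then have "card K < card H" by (rule psubset_card_mono[OF finH])
    then show "\<forall>x\<in>K. \<forall>y\<in>K. x \<otimes> y = y \<otimes> x"
      using least[of K] incl_subgroup[OF subH K(1)] by fastforce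
  qed
  then obtain A x0 y0 where AH: "subgroup A (G\<lparr>carrier := H\<rparr>)"
    and Acomm: "\<And>a b. a \<in> A \<Longrightarrow> b \<in> A \<Longrightarrow> a \<otimes> b = b \<otimes> a"
    and Anorm: "\<And>g a. g \<in> H \<Longrightarrow> a \<in> A \<Longrightarrow> g \<otimes> a \<otimes> inv g \<in> A"
    and xy: "x0 \<in> H" "y0 \<in> A" "y0 \<otimes> x0 \<noteq> x0 \<otimes> y0"
    using m_inv_consistent[OF subH] by (metis (no_types, lifting))
  have A: "subgroup A G" using incl_subgroup[OF subH AH] .
  note AG = subgroup.mem_carrier[OF A] and HG = subgroup.mem_carrier[OF subH]
  \<comment> \<open>The pair is refined one entry at a time: \<open>x\<close> is chosen against
    \<open>y0\<close>, and then \<open>y\<close> against the new \<open>x\<close>. The two primes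
    may still differ.\<close>
  obtain x p l where x: "x \<in> H" "Factorial_Ring.prime (p::nat)" "x [^] (p ^ l) = \<one>"
      "x \<otimes> y0 \<noteq> y0 \<otimes> x"
    using prime_power_noncommuting[OF fin subH xy(1) AG[OF xy(2)] xy(3)[symmetric]] by blast
  obtain y q m where y: "y \<in> A" "Factorial_Ring.prime (q::nat)" "y [^] (q ^ m) = \<one>"
      "y \<otimes> x \<noteq> x \<otimes> y"
    using prime_power_noncommuting[OF fin A xy(2) HG[OF x(1)] x(4)[symmetric]] by blast
  \<comment> \<open>The \<open>q\<close>-part of the abelian group \<open>A\<close>. Conjugation by
    \<open>x\<close> preserves \<open>A\<close> and \<open>q\<close>-power torsion, hence also
    \<open>Q\<close>.\<close>
  define Q where "Q = {a \<in> A. \<exists>k. a [^] (q ^ k) = \<one>}"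
  have subQ: "subgroup Q G"
  proof (rule finite_subgroupI[OF fin])
    show "Q \<subseteq> carrier G" using AG by (auto simp: Q_def)
    show "Q \<noteq> {}" using y by (auto simp: Q_def)
    fix u v assume "u \<in> Q" "v \<in> Q"
    then obtain k l where uv: "u \<in> A" "v \<in> A" "u [^] (q ^ k) = \<one>" "v [^] (q ^ l) = \<one>"
      by (auto simp: Q_def)
    have "(u \<otimes> v) [^] (q ^ (k + l)) = u [^] (q ^ k * q ^ l) \<otimes> v [^] (q ^ l * q ^ k)"
      using pow_mult_distrib[OF Acomm[OF uv(1,2)] AG AG] uv by (simp add: power_add mult.commute)
    also have "\<dots> = \<one>" using uv AG by (simp flip: nat_pow_pow)
    finally show "u \<otimes> v \<in> Q" using uv subgroup.m_closed[OF A] by (auto simp: Q_def)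
  qed
  have "\<exists>a\<in>Q. \<exists>z. z \<noteq> \<one> \<and> central_commutator G a x z"
  proof (rule exists_central_commutator[OF fin IC subQ y(2)])
    show "x \<otimes> u \<otimes> inv x \<in> Q" if u: "u \<in> Q" for u
    proof -
      obtain k where k: "u \<in> A" "u [^] (q ^ k) = \<one>" using u by (auto simp: Q_def)
      have "(x \<otimes> u \<otimes> inv x) [^] (q ^ k) = \<one>"
        using k x(1) AG HG by (simp add: conj_nat_pow)
      then show ?thesis using Anorm[OF x(1) k(1)] by (auto simp: Q_def)
    qed
  qed (use y x HG Acomm in \<open>auto simp: Q_def\<close>)
  then obtain a z k where a: "z \<noteq> \<one>" "central_commutator G a x z" "a [^] (q ^ k) = \<one>"
    by (auto simp: Q_def)
  interpret ax: central_commutator G a x z by (rule a(2))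
  \<comment> \<open>The order of the commutator \<open>z\<close> divides both \<open>p ^ l\<close>
    and \<open>q ^ k\<close>.\<close>
  have "p = q"
  proof (rule ccontr)
    assume "p \<noteq> q"
    then have "coprime (p ^ l) (q ^ k)" using x(2) y(2) primes_coprime by auto
    moreover have "ord z dvd p ^ l" "ord z dvd q ^ k"
      using ax.pow_eq_one_left[OF a(3)] ax.pow_eq_one_right[OF x(3)] pow_eq_id by auto
    ultimately have "ord z = 1" by (metis coprime_common_divisor_nat nat_dvd_1_iff_1)
    then show False using a(1) ord_eq_1 ax.z_carrier by blast
  qed
  then show ?thesis using a x(2,3) by blast
qed

section \<open>The quaternion relations\<close>

lemma prime_not_dvd_choose_two:
  assumes p: "Factorial_Ring.prime (p::nat)" and j: "j > 0"
    and ndvd: "\<not> p dvd (p ^ j choose 2)"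
  shows "p = 2 \<and> j = 1"
proof -
  obtain i where i: "j = Suc i" using j gr0_implies_Suc by blast
  have "even (p ^ j * (p ^ j - 1))" by auto
  \<comment> \<open>For odd \<open>p\<close> the factor 2 is coprime to \<open>p\<close>. For
    \<open>p = 2\<close> it cancels the leading \<open>p\<close>, and the rest is still divisible by
    \<open>p\<close> unless \<open>i = 0\<close>.\<close>
  then have two: "2 * (p ^ j choose 2) = p * (p ^ i * (p ^ j - 1))"
    by (simp add: choose_two i mult.assoc)
  have "p = 2"
  proof (rule ccontr)
    assume "p \<noteq> 2"
    then have "coprime p 2" using primes_coprime[OF p two_is_prime_nat] by simp
    moreover have "p dvd 2 * (p ^ j choose 2)" using two by simp
    ultimately show False using ndvd by (simp add: coprime_dvd_mult_right_iff)
  qed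
  moreover have "i = 0"
  proof (rule ccontr)
    assume "i \<noteq> 0"
    then have "p dvd p ^ i * (p ^ j - 1)" by simp
    then show False using two ndvd \<open>p = 2\<close> by simp
  qed
  ultimately show ?thesis using i by simp
qed

lemma (in group) ord_prime_power:
  assumes "x \<in> carrier G" "x \<noteq> \<one>" "Factorial_Ring.prime (p::nat)" "x [^] (p ^ k) = \<one>"
  shows "\<exists>i. ord x = p ^ Suc i"
proof -
  have "ord x dvd p ^ k" using assms pow_eq_id by blast
  then obtain i where i: "ord x = p ^ i" using divides_primepow_nat assms(3) by blast
  moreover have "i \<noteq> 0"
  proof
    assume "i = 0"
    then show False using i assms(2) ord_eq_1[OF assms(1)] by simp
  qed
  ultimately show ?thesis by (metis not0_implies_Suc)
qed

text \<open>The cyclic group generated by \<open>b\<close> has a single subgroup of order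
  \<open>p\<close>. Both \<open>z\<close> and \<open>b^(p^j)\<close> generate it, so each is a power
  of the other.\<close>

lemma (in group) socle_element_power:
  assumes b: "b \<in> carrier G" and p: "Factorial_Ring.prime (p::nat)" and j: "ord b = p ^ Suc j"
    and z: "z = b [^] (m::nat)" "z \<noteq> \<one>" "z [^] p = \<one>"
  shows "(\<exists>t::nat. b [^] (p ^ j) = z [^] t) \<and> (\<exists>s. \<not> p dvd s \<and> z = (b [^] (p ^ j)) [^] s)"
proof -
  have "b [^] (m * p) = \<one>" using b z by (simp add: nat_pow_pow)
  then have "p ^ Suc j dvd m * p" using pow_eq_id b j by metis
  then have "p ^ j dvd m" using prime_gt_0_nat[OF p] by simp
  then obtain s where "m = p ^ j * s" by blast
  then have s: "z = (b [^] (p ^ j)) [^] s" using b z by (simp add: nat_pow_pow)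
  have B: "(b [^] (p ^ j)) [^] p = \<one>"
    using b j pow_ord_eq_1[OF b] by (simp add: nat_pow_pow mult.commute)
  have ndvd: "\<not> p dvd s"
  proof
    assume "p dvd s"
    then obtain r where "s = p * r" by blast
    then have "z = ((b [^] (p ^ j)) [^] p) [^] r" using s b by (simp add: nat_pow_pow mult.assoc)
    then show False using B z(2) by simp
  qed
  moreover obtain t :: nat where "((b [^] (p ^ j)) [^] s) [^] t = b [^] (p ^ j)"
    using pow_coprime_inverse[OF _ B p ndvd] b by auto
  ultimately show ?thesis using s by metis
qed

text \<open>
  Choose \<open>a, b\<close> with \<open>ord a + ord b\<close> minimal, say with \<open>ord b \<le> ord a\<close>. As \<open>z\<close> lies in both
  \<open>\<langle>a\<rangle>\<close> and \<open>\<langle>b\<rangle>\<close>, a suitable \<open>c = b a\<^sup>m\<close> has \<open>c\<^bsup>ord b / p\<^esup> = \<one>\<close> up to the correction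
  \<open>z\<^bsup>m (ord b / p choose 2)\<^esup>\<close>, and could replace \<open>b\<close> unless that correction survives.
\<close>

lemma (in group) quaternion_relations:
  assumes fin: "finite (carrier G)"
    and IC: "\<And>H. primary_subgroup H G \<Longrightarrow> IC_Phi_subgroup H G"
    and nonab: "\<not> comm_group G"
  shows "\<exists>a b z. central_commutator G a b z \<and> z \<noteq> \<one> \<and> a \<otimes> a = z \<and> b \<otimes> b = z \<and> z \<otimes> z = \<one>"
proof -
  obtain a0 b0 z0 k0 l0 and p :: nat where p: "Factorial_Ring.prime p"
    and start: "z0 \<noteq> \<one>" "central_commutator G a0 b0 z0"
      "a0 [^] (p ^ k0) = \<one>" "b0 [^] (p ^ l0) = \<one>"
    using exists_prime_power_central_commutator[OF fin IC nonab] by blast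
  define P where "P = (\<lambda>(a, b). \<exists>z k l. z \<noteq> \<one> \<and> central_commutator G a b z \<and>
    a [^] (p ^ k) = \<one> \<and> b [^] (p ^ l) = \<one>)"
  define f where "f = (\<lambda>(a, b). ord a + ord b)"
  \<comment> \<open>Inverting the commutator makes \<open>P\<close> symmetric, so a minimal pair can
    be arranged with \<open>ord b \<le> ord a\<close>.\<close>
  have P_swap: "P (b, a)" if Pab: "P (a, b)" for a b
  proof -
    obtain z k l where z: "z \<noteq> \<one>" "central_commutator G a b z"
      "a [^] (p ^ k) = \<one>" "b [^] (p ^ l) = \<one>" using Pab by (auto simp: P_def)
    interpret central_commutator G a b z by (rule z(2))
    have "inv z \<noteq> \<one>" using z(1) by simp
    then show ?thesis using z(3,4) swap unfolding P_def by blast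
  qed
  have "P (a0, b0)" using start unfolding P_def by blast
  then obtain u where u: "P u" "\<And>v. P v \<Longrightarrow> f u \<le> f v"
    using ex_has_least_nat[of P "(a0, b0)" f] by blast
  have "\<exists>a b. P (a, b) \<and> ord b \<le> ord a \<and> (\<forall>a' b'. P (a', b') \<longrightarrow> ord a + ord b \<le> ord a' + ord b')"
  proof (cases "ord (snd u) \<le> ord (fst u)")
    case True
    then show ?thesis
      using u by (intro exI[of _ "fst u"] exI[of _ "snd u"]) (fastforce simp: f_def split_beta)
  next
    case False
    then show ?thesis
      using u P_swap[of "fst u" "snd u"]
      by (intro exI[of _ "snd u"] exI[of _ "fst u"]) (fastforce simp: f_def split_beta)
  qed
  then obtain a b where Pab: "P (a, b)" and ba: "ord b \<le> ord a"
    and least: "\<And>a' b'. P (a', b') \<Longrightarrow> ord a + ord b \<le> ord a' + ord b'"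
    by blast
  obtain z k l where z: "z \<noteq> \<one>" "central_commutator G a b z"
    and ak: "a [^] (p ^ k) = \<one>" and bl: "b [^] (p ^ l) = \<one>" using Pab by (auto simp: P_def)
  interpret ab: central_commutator G a b z by (rule z(2))
  interpret ba: central_commutator G b a "inv z" by (rule ab.swap)
  note [simp] = ab.a_carrier ab.b_carrier ab.z_carrier
  have p1: "p > 1" using prime_gt_1_nat[OF p] .
  have ne: "a \<noteq> \<one>" "b \<noteq> \<one>"
    using ab.commute_iff z(1) by auto
  obtain i where i: "ord a = p ^ Suc i" using ord_prime_power[OF _ ne(1) p ak] by auto
  obtain j where j: "ord b = p ^ Suc j" using ord_prime_power[OF _ ne(2) p bl] by auto
  have ji: "j \<le> i" using power_le_imp_le_exp[of p "Suc j" "Suc i"] ba i j p1 by simp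
  have ordP: "x [^] (p ^ Suc i) = \<one>" if "ord x = p ^ Suc i" "x \<in> carrier G" for x i
    using pow_ord_eq_1[OF that(2)] that(1) by simp
  \<comment> \<open>Otherwise \<open>a^p\<close> and \<open>b\<close> have the nontrivial commutator
    \<open>z^p\<close>, while \<open>ord (a^p) < ord a\<close>.\<close>
  have zp: "z [^] p = \<one>"
  proof (rule ccontr)
    assume "z [^] p \<noteq> \<one>"
    have 1: "(a [^] p) [^] (p ^ i) = \<one>" using ordP[OF i] by (simp add: nat_pow_pow)
    then have "P (a [^] p, b)"
      using \<open>z [^] p \<noteq> \<one>\<close> ab.pow_left[of p] bl unfolding P_def by blast
    then have "ord a \<le> ord (a [^] p)" using least by force
    also have "\<dots> \<le> p ^ i"
      using 1 pow_eq_id[of "a [^] p"] p1 by (intro dvd_imp_le) auto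
    finally show False using i p1 by simp
  qed
  obtain n :: nat where n: "z = a [^] n" using ab.z_eq_power[OF fin IC p ak zp] by blast
  have "inv z [^] p = \<one>" using zp by (simp add: nat_pow_inv)
  then obtain m' :: nat where m': "inv z = b [^] m'"
    using ba.z_eq_power[OF fin IC p bl] by blast
  \<comment> \<open>The swapped pair yields \<open>inv z\<close> as a power of \<open>b\<close>. As
    \<open>z\<close> has exponent \<open>p\<close>, raising to the power \<open>p - 1\<close> turns
    this into a natural power equal to \<open>z\<close>.\<close>
  have "z = inv (inv z)" by simp
  also have "\<dots> = (inv z) [^] (p - 1)"
  proof -
    have "inv z [^] (p - 1) \<otimes> inv z = \<one>"
      using \<open>inv z [^] p = \<one>\<close> p1 nat_pow_Suc[of "inv z" "p - 1"] by simp
    then show ?thesis by (rule inv_equality) simp_all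
  qed
  finally have m: "z = b [^] (m' * (p - 1))" using m' by (simp add: nat_pow_pow)
  obtain s where s: "\<not> p dvd s" "z = (a [^] (p ^ i)) [^] s"
    using socle_element_power[OF _ p i n z(1) zp] by auto
  obtain t s' :: nat where t: "b [^] (p ^ j) = z [^] t"
    and s': "\<not> p dvd s'" "z = (b [^] (p ^ j)) [^] s'"
    using socle_element_power[OF _ p j m z(1) zp] by auto
  \<comment> \<open>The factor \<open>p - 1\<close> stands for -1 modulo \<open>p\<close>:
    \<open>q\<close> is chosen so that \<open>a^(q p^j) = z^(t (p - 1))\<close> is the inverse of
    \<open>b^(p^j) = z^t\<close>.\<close>
  define r where "r = s * t * (p - 1)"
  define q where "q = p ^ (i - j) * r"
  have "p ^ i = p ^ j * p ^ (i - j)" using ji by (simp flip: power_add)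
  then have "q * p ^ j = p ^ i * r" by (simp add: q_def)
  then have "a [^] (q * p ^ j) = (z [^] t) [^] (p - 1)"
    by (subst s(2)) (simp add: nat_pow_pow r_def mult.assoc)
  then have "b [^] (p ^ j) \<otimes> a [^] (q * p ^ j) = z [^] (t + t * (p - 1))"
    by (simp add: t nat_pow_pow nat_pow_mult)
  also have "t + t * (p - 1) = p * t" using p1 by (cases p) simp_all
  finally have cancel: "b [^] (p ^ j) \<otimes> a [^] (q * p ^ j) = \<one>" using zp by (simp flip: nat_pow_pow)
  define c where "c = b \<otimes> a [^] q"
  have "c [^] (p ^ j) = b [^] (p ^ j) \<otimes> (a [^] q) [^] (p ^ j) \<otimes> (z [^] q) [^] (p ^ j choose 2)"
    unfolding c_def by (rule central_commutator.pow_mult[OF ab.pow_left])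
  then have cpow: "c [^] (p ^ j) = z [^] (q * (p ^ j choose 2))"
    using cancel by (simp add: nat_pow_pow)
  have cG: "c \<in> carrier G" by (simp add: c_def)
  have "c [^] (p ^ Suc j) = (c [^] (p ^ j)) [^] p" using cG by (simp add: nat_pow_pow mult.commute)
  also have "\<dots> = (z [^] p) [^] (q * (p ^ j choose 2))" by (simp add: cpow nat_pow_pow mult.commute)
  finally have "c [^] (p ^ Suc j) = \<one>" by (simp add: zp)
  \<comment> \<open>The commutator is still \<open>z\<close>, so minimality rules out
    \<open>ord c < ord b\<close>. Hence \<open>c^(p^j)\<close>, which equals the correction term, is
    nontrivial.\<close>
  then have "P (a, c)"
    using z(1) ak ab.mult_pow_right[of q] unfolding P_def c_def by blast
  then have "ord b \<le> ord c" using least by force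
  moreover have "p ^ j < p ^ Suc j" "p ^ j > 0" using p1 by auto
  ultimately have "\<not> ord c dvd p ^ j" using j dvd_imp_le[of "ord c" "p ^ j"] by linarith
  then have "c [^] (p ^ j) \<noteq> \<one>" using pow_eq_id cG by blast
  moreover have "z [^] (p * e) = \<one>" for e :: nat using zp by (simp flip: nat_pow_pow)
  ultimately have ndvd: "\<not> p dvd q * (p ^ j choose 2)" using cpow by (metis dvdE)
  have "i = j"
  proof (rule ccontr)
    assume "i \<noteq> j"
    then have "p dvd q" using ji by (simp add: q_def)
    then show False using ndvd by simp
  qed
  \<comment> \<open>For \<open>j = 0\<close> the element \<open>b\<close> itself would be a power of
    \<open>z\<close>, which commutes with \<open>a\<close>.\<close>
  have "j > 0"
  proof (rule ccontr)
    assume "\<not> j > 0"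
    then have "b = z [^] t" using t by simp
    then have "a \<otimes> b = b \<otimes> a" using ab.zpow_a[of t] by simp
    then show False using ab.commute_iff z(1) by blast
  qed
  moreover have "\<not> p dvd (p ^ j choose 2)" using ndvd dvd_mult by blast
  ultimately have p2: "p = 2" "j = 1" using prime_not_dvd_choose_two[OF p] by blast+
  have zz: "z \<otimes> z = \<one>" using zp p2 by (simp add: numeral_2_eq_2)
  \<comment> \<open>Here \<open>x\<close> has order 4 and \<open>e\<close> is odd, so
    \<open>x^(2 e)\<close> reduces to \<open>x^2\<close>.\<close>
  have square: "x \<otimes> x = z"
    if x: "x \<in> carrier G" "ord x = p ^ Suc 1" "\<not> p dvd e" "z = (x [^] (p ^ 1)) [^] e" for x e
  proof -
    obtain d where d: "e = Suc (2 * d)" using x(3) p2 by (metis oddE Suc_eq_plus1)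
    have "((x [^] p) [^] p) [^] d = \<one>"
      using ordP[OF x(2,1)] x(1) by (simp add: nat_pow_pow)
    then have "z = x [^] p" using x(1,4) d p2 by (simp add: nat_pow_pow mult.assoc)
    then show ?thesis using x(1) p2 by (simp add: numeral_2_eq_2)
  qed
  have "a \<otimes> a = z" using square[of a s] i s \<open>i = j\<close> p2 by simp
  moreover have "b \<otimes> b = z" using square[of b s'] j s' p2 by simp
  ultimately show ?thesis using z zz by blast
qed

section \<open>Embedding the quaternion group\<close>

lemma (in group) not_Q8_freeI:
  assumes cc: "central_commutator G a b z" and z: "z \<noteq> \<one>"
    and rel: "a \<otimes> a = z" "b \<otimes> b = z" "z \<otimes> z = \<one>"
  shows "\<not> Q8_free G"
proof -
  interpret central_commutator G a b z by (rule cc)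
  define g where "g u = (case u of Q1 \<Rightarrow> \<one> | Qi \<Rightarrow> a | Qj \<Rightarrow> b | Qk \<Rightarrow> a \<otimes> b)" for u
  define f where "f = (\<lambda>(s, u). (if s then z else \<one>) \<otimes> g u)"
  have g_closed [simp]: "g u \<in> carrier G" for u by (cases u) (auto simp: g_def)
  have f_closed [simp]: "f v \<in> carrier G" for v by (cases v) (auto simp: f_def)
  \<comment> \<open>\<open>ba\<close>, \<open>zl\<close> and \<open>ll\<close> rewrite products to a
    normal form with \<open>z\<close> first, then \<open>a\<close>, then \<open>b\<close>, so the
    multiplication table can be checked case by case.\<close>
  have ba: "b \<otimes> a = z \<otimes> (a \<otimes> b)"
    by (simp add: ab rel flip: m_assoc)
  have zl: "a \<otimes> (z \<otimes> w) = z \<otimes> (a \<otimes> w)" "b \<otimes> (z \<otimes> w) = z \<otimes> (b \<otimes> w)" if "w \<in> carrier G" for w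
    using that by (simp_all add: left_commuteI az bz)
  have ll: "a \<otimes> (a \<otimes> w) = z \<otimes> w" "b \<otimes> (b \<otimes> w) = z \<otimes> w" "z \<otimes> (z \<otimes> w) = w"
    "b \<otimes> (a \<otimes> w) = z \<otimes> (a \<otimes> (b \<otimes> w))" if "w \<in> carrier G" for w
    using that by (simp_all add: rel flip: m_assoc) (simp add: ba m_assoc)
  have "f (quat_mult (s, u) (t, v)) = f (s, u) \<otimes> f (t, v)" for s u t v
    by (cases u; cases v) (auto simp: f_def g_def m_assoc rel ba zl ll az bz)
  then have hom: "f (quat_mult v w) = f v \<otimes> f w" for v w
    by (cases v, cases w) (simp only:)
  have nc: "a \<otimes> b \<noteq> b \<otimes> a" using commute_iff z by simp
  \<comment> \<open>Any other element of the kernel would give \<open>z = 1\<close> or force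
    \<open>a\<close> and \<open>b\<close> to commute.\<close>
  have inj_one: "v = (False, Q1)" if v: "f v = \<one>" for v
  proof -
    have a1: "a \<noteq> z" "a \<noteq> \<one>" "b \<noteq> z" "b \<noteq> \<one>" "a \<noteq> b" using nc az bz by auto
    obtain s u where su: "v = (s, u)" by force
    show ?thesis
    proof (cases u)
      case Q1
      then show ?thesis using v su z by (auto simp: f_def g_def split: if_splits)
    next
      case Qi
      have "z \<otimes> a \<noteq> \<one>"
        using a1(1) rel(3) l_cancel[of z a z] by auto
      then show ?thesis using v su a1 Qi by (auto simp: f_def g_def split: if_splits)
    next
      case Qj
      have "z \<otimes> b \<noteq> \<one>"
        using a1(3) rel(3) l_cancel[of z b z] by auto
      then show ?thesis using v su a1 Qj by (auto simp: f_def g_def split: if_splits)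
    next
      case Qk
      have "z \<otimes> (a \<otimes> b) \<noteq> \<one>"
      proof
        assume "z \<otimes> (a \<otimes> b) = \<one>"
        then have "b \<otimes> a = \<one>" using ba by simp
        then have "a \<otimes> b = \<one>" using inv_comm by simp
        then show False using nc \<open>b \<otimes> a = \<one>\<close> by simp
      qed
      moreover have "a \<otimes> b \<noteq> \<one>"
        using nc inv_comm[of a b] by auto
      ultimately show ?thesis using v su Qk by (auto simp: f_def g_def split: if_splits)
    qed
  qed
  interpret Q8: group Q8 by (rule group_Q8)
  have carrier_Q8: "carrier Q8 = UNIV" by (simp add: Q8_def)
  define A where "A = range f"
  have gh: "group_hom Q8 G f"
    by unfold_locales (auto simp: hom_def Q8_def hom simp del: quat_mult.simps)
  interpret f: group_hom Q8 G f by (rule gh)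
  have subA: "subgroup A G" using f.img_is_subgroup by (simp add: A_def carrier_Q8)
  interpret A: group "G\<lparr>carrier := A\<rparr>" using subA by (rule subgroup_imp_group)
  have one_Q8: "\<one>\<^bsub>Q8\<^esub> = (False, Q1)" by (simp add: Q8_def)
  have "inj_on f (carrier Q8)"
    unfolding f.inj_on_one_iff one_Q8 by (intro allI impI inj_one)
  then have "inj f" by (simp only: carrier_Q8)
  then have "f \<in> iso Q8 (G\<lparr>carrier := A\<rparr>)"
    by (auto simp: iso_def hom_def bij_betw_def A_def Q8_def hom simp del: quat_mult.simps)
  then have "G\<lparr>carrier := A\<rparr> \<cong> Q8" using Q8.iso_sym unfolding is_iso_def by blast
  \<comment> \<open>Dividing by the trivial subgroup presents the subgroup \<open>A\<close> as a
    section.\<close>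
  moreover have "G\<lparr>carrier := A\<rparr> Mod {\<one>} \<cong> G\<lparr>carrier := A\<rparr>"
    using A.trivial_factor_iso unfolding is_iso_def by auto
  ultimately have "(G\<lparr>carrier := A\<rparr> Mod {\<one>}) \<cong> Q8" using iso_trans by blast
  moreover have "{\<one>} \<lhd> G\<lparr>carrier := A\<rparr>" using A.one_is_normal by simp
  ultimately show ?thesis using subA unfolding Q8_free_def by blast
qed

section \<open>Abelian groups and the equivalence\<close>

lemma (in comm_group) Q8_free: "Q8_free G"
  unfolding Q8_free_def
proof clarify
  fix A B assume A: "subgroup A G" and B: "B \<lhd> G\<lparr>carrier := A\<rparr>"
    and iso: "G\<lparr>carrier := A\<rparr> Mod B \<cong> Q8"
  interpret A: comm_group "G\<lparr>carrier := A\<rparr>"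
    using A by (intro group.group_comm_groupI subgroup_imp_group) (auto simp: m_comm subgroup.mem_carrier)
  interpret M: comm_group "G\<lparr>carrier := A\<rparr> Mod B"
    using A.abelian_FactGroup normal_imp_subgroup[OF B] by blast
  interpret Q8: comm_group Q8
    using M.iso_imp_comm_group[OF iso] group_Q8 group.is_monoid by blast
  \<comment> \<open>Sections of an abelian group are abelian, whereas \<open>i\<close> and
    \<open>j\<close> do not commute in \<open>Q8\<close>.\<close>
  show False using Q8.m_comm[of "(False, Qi)" "(False, Qj)"] by (simp add: Q8_def)
qed

text \<open>All commutators are trivial, so \<open>H \<inter> [H, G]\<close> contains only the
  identity, which lies in every maximal subgroup of \<open>H\<close>.\<close>

lemma (in comm_group) IC_Phi_subgroup:
  assumes H: "subgroup H G" shows "IC_Phi_subgroup H G"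
proof -
  have "h \<otimes> k \<otimes> inv h \<otimes> inv k = \<one>" if "h \<in> H" "k \<in> carrier G" for h k
    using that subgroup.mem_carrier[OF H] by (simp add: m_comm[of h k] m_assoc)
  then have "commutator_subgroup G H (carrier G) \<subseteq> generate G {\<one>}"
    unfolding commutator_subgroup_def by (intro mono_generate) auto
  then have "commutator_subgroup G H (carrier G) \<subseteq> {\<one>}" using generate_one by simp
  moreover have "\<one> \<in> frattini (G\<lparr>carrier := H\<rparr>)"
    using subgroup.one_closed[OF H] subgroup.one_closed
    by (fastforce simp: frattini_def maximal_subgroup_def)
  ultimately show ?thesis using H unfolding IC_Phi_subgroup_def by blast
qed

theorem theorem1p6:
  fixes G (structure)
  assumes "group G" and "finite (carrier G)"
  shows "(comm_group G \<longleftrightarrow>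
            Q8_free G \<and> (\<forall>H. subgroup H G \<longrightarrow> IC_Phi_subgroup H G)) \<and>
         (comm_group G \<longleftrightarrow>
            Q8_free G \<and> (\<forall>H. primary_subgroup H G \<longrightarrow> IC_Phi_subgroup H G))"
proof -
  interpret group G by fact
  \<comment> \<open>Deriving commutativity from the primary subgroups settles both equivalences,
    because the condition on all subgroups includes the one on primary subgroups.\<close>
  have "comm_group G"
    if "Q8_free G" "\<And>H. primary_subgroup H G \<Longrightarrow> IC_Phi_subgroup H G"
    using quaternion_relations[OF assms(2) that(2)] not_Q8_freeI that(1) by blast
  moreover have "primary_subgroup H G \<Longrightarrow> subgroup H G" for H
    by (simp add: primary_subgroup_def)
  ultimately show ?thesis
    using comm_group.Q8_free comm_group.IC_Phi_subgroup by blast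
qed

end
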